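(* For every $n\ge 4$, $\mathrm{st}(n,P_4)=\mathrm{ex}(n,\{C_3,C_4\})$.
   Context: Graphs are finite and simple; $P_4$ is the path on 4 vertices, $C_i$ is the cycle on $i$ vertices. $\mathrm{ex}(n,\mathcal F)$ is the maximum number of edges of a graph on $n$ vertices containing no (not necessarily induced) copy of any member of $\mathcal F$. For a non-complete graph $G$ on $k$ vertices and $n\ge k$, $\mathrm{st}(n,G)$ is the largest $m$ for which there is a graph $H$ with $n$ vertices and $m$ edges such that no subgraph $F\subseteq H$ on exactly $k$ vertices contains $G$ as a proper subgraph. *)

theory Defs
  imports Main
begin

record 'a graph =
  verts :: "'a set"
  edges :: "'a set set"

definition simple_graph :: "'a graph \<Rightarrow> bool" where
  "simple_graph H \<longleftrightarrow> finite (verts H) \<and> (\<forall>e\<in>edges H. e \<subseteq> verts H \<and> card e = 2)"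

definition subgraph :: "'a graph \<Rightarrow> 'a graph \<Rightarrow> bool" where
  "subgraph F H \<longleftrightarrow> simple_graph F \<and> simple_graph H \<and>
     verts F \<subseteq> verts H \<and> edges F \<subseteq> edges H"

definition proper_subgraph :: "'a graph \<Rightarrow> 'a graph \<Rightarrow> bool" where
  "proper_subgraph F H \<longleftrightarrow> subgraph F H \<and> F \<noteq> H"

definition isomorphic :: "'a graph \<Rightarrow> 'b graph \<Rightarrow> bool" where
  "isomorphic F G \<longleftrightarrow>
     (\<exists>f. bij_betw f (verts F) (verts G) \<and> edges G = (\<lambda>e. f ` e) ` edges F)"

definition contains_copy :: "'a graph \<Rightarrow> 'b graph \<Rightarrow> bool" where
  "contains_copy H G \<longleftrightarrow> (\<exists>G'. subgraph G' H \<and> isomorphic G' G)"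

definition contains_copy_properly :: "'a graph \<Rightarrow> 'b graph \<Rightarrow> bool" where
  "contains_copy_properly F G \<longleftrightarrow> (\<exists>G'. proper_subgraph G' F \<and> isomorphic G' G)"

text \<open>The host graphs in the two extremal functions below have natural numbers as vertices,
  with an arbitrary vertex set of the prescribed size; every finite graph is isomorphic to such
  a graph.\<close>

definition ex :: "nat \<Rightarrow> 'b graph set \<Rightarrow> nat" where
  "ex n \<F> = Max {card (edges H) | H :: nat graph.
     simple_graph H \<and> card (verts H) = n \<and> (\<forall>G\<in>\<F>. \<not> contains_copy H G)}"

text \<open>Intended for non-complete \<open>G\<close> and \<open>n \<ge> card (verts G)\<close>.\<close>

definition st :: "nat \<Rightarrow> 'b graph \<Rightarrow> nat" where
  "st n G = Max {card (edges H) | H :: nat graph.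
     simple_graph H \<and> card (verts H) = n \<and>
     \<not> (\<exists>F. subgraph F H \<and> card (verts F) = card (verts G) \<and> contains_copy_properly F G)}"

definition path_graph :: "nat \<Rightarrow> nat graph" where
  "path_graph k = \<lparr>verts = {..<k}, edges = {{i, Suc i} | i. Suc i < k}\<rparr>"

text \<open>A cycle only for \<open>k \<ge> 3\<close>.\<close>

definition cycle_graph :: "nat \<Rightarrow> nat graph" where
  "cycle_graph k = \<lparr>verts = {..<k}, edges = {{i, Suc i mod k} | i. i < k}\<rparr>"

text \<open>The maxima above are taken over finite sets, which are nonempty whenever the forbidden
  graphs have edges, so \<open>Max\<close> is the true maximum.\<close>

lemma finite_edge_counts:
  "finite {card (edges H) | H :: nat graph. simple_graph H \<and> card (verts H) = n \<and> P H}"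
proof (rule finite_subset)
  show "{card (edges H) | H :: nat graph. simple_graph H \<and> card (verts H) = n \<and> P H} \<subseteq> {..2 ^ n}"
  proof clarsimp
    fix H :: "nat graph"
    assume "simple_graph H"
    then have "finite (verts H)" "edges H \<subseteq> Pow (verts H)"
      by (auto simp: simple_graph_def)
    then show "card (edges H) \<le> 2 ^ card (verts H)"
      by (metis card_Pow card_mono finite_Pow_iff)
  qed
qed simp

lemma edgeless_avoids:
  assumes "edges H = {}" "edges G \<noteq> {}"
  shows "\<not> contains_copy H G"
  using assms by (auto simp: contains_copy_def subgraph_def isomorphic_def)

lemma edgeless_avoids_properly:
  assumes "edges H = {}" "edges G \<noteq> {}" "subgraph F H"
  shows "\<not> contains_copy_properly F G"
  using assms
  by (auto simp: contains_copy_properly_def proper_subgraph_def subgraph_def isomorphic_def)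

end

theory Submission imports Defs
begin

text \<open>On four vertices, a graph properly containing \<open>P\<^sub>4\<close> contains \<open>C\<^sub>4\<close> or a paw (a triangle with
  a pendant edge), and both of these properly contain \<open>P\<^sub>4\<close>. Hence the host graphs admitted by
  \<open>st n P\<^sub>4\<close> are the graphs without \<open>C\<^sub>4\<close> in which every triangle is a whole component
  (\<open>extended_path_iff\<close>), and they include those admitted by \<open>ex n {C\<^sub>3, C\<^sub>4}\<close>.

  Conversely, on at least four vertices such a graph can be made triangle-free without changing
  its number of edges and without creating a \<open>C\<^sub>4\<close> (\<open>eliminate_triangles\<close>). Each step
  removes one edge from one or two triangle components, which turns them into paths, and puts the
  same number of edges back. If \<open>a b c\<close> is a triangle and some vertex \<open>d\<close> lies in no triangle,
  the edge \<open>b c\<close> is replaced by \<open>c d\<close>, which hangs the path \<open>b a c\<close> on \<open>d\<close>. Otherwise all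
  components are triangles and there are at least two of them, which are opened up and joined
  into a \<open>C\<^sub>6\<close>. Adding an edge is harmless when its ends are not joined by a walk of length two or
  three (\<open>c4_free_insert\<close>, \<open>triangle_insert\<close>). So the two extremal functions are maxima of the
  same set of edge counts.\<close>

section \<open>Triangles and four-cycles in edge sets\<close>

text \<open>The notions below speak of a set of edges only. In a loop-free edge set adjacent vertices are
  distinct, so distinctness is required only of the opposite vertices of a four-cycle.\<close>

definition loop_free :: "'a set set \<Rightarrow> bool" where
  "loop_free E \<longleftrightarrow> (\<forall>v. {v} \<notin> E)"

definition triangle :: "'a set set \<Rightarrow> 'a \<Rightarrow> 'a \<Rightarrow> 'a \<Rightarrow> bool" where
  "triangle E a b c \<longleftrightarrow> {a, b} \<in> E \<and> {b, c} \<in> E \<and> {a, c} \<in> E"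

definition c4_free :: "'a set set \<Rightarrow> bool" where
  "c4_free E \<longleftrightarrow>
     (\<forall>a b c d. {a, b} \<in> E \<and> {b, c} \<in> E \<and> {c, d} \<in> E \<and> {d, a} \<in> E \<longrightarrow> a = c \<or> b = d)"

text \<open>No edge leaves a triangle.\<close>

definition paw_free :: "'a set set \<Rightarrow> bool" where
  "paw_free E \<longleftrightarrow> (\<forall>a b c d. triangle E a b c \<and> {c, d} \<in> E \<longrightarrow> d = a \<or> d = b)"

definition triangle_verts :: "'a set set \<Rightarrow> 'a set" where
  "triangle_verts E = {a. \<exists>b c. triangle E a b c}"

lemma triangle_rotate: "triangle E a b c \<Longrightarrow> triangle E b c a"
  by (auto simp: triangle_def insert_commute)

lemma c4_free_subset: "c4_free E \<Longrightarrow> D \<subseteq> E \<Longrightarrow> c4_free D"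
  unfolding c4_free_def by blast

lemma triangle_subset: "triangle D a b c \<Longrightarrow> D \<subseteq> E \<Longrightarrow> triangle E a b c"
  unfolding triangle_def by blast

lemma loop_freeD: "loop_free E \<Longrightarrow> {x, y} \<in> E \<Longrightarrow> x \<noteq> y"
  by (auto simp: loop_free_def)

lemma paw_freeD:
  assumes "paw_free E" "triangle E a b c" "v \<in> {a, b, c}" "{v, w} \<in> E"
  shows "w \<in> {a, b, c}"
  using assms triangle_rotate[OF assms(2)] triangle_rotate[OF triangle_rotate[OF assms(2)]]
  unfolding paw_free_def by blast

lemma c4_free_insert:
  assumes "c4_free E" "loop_free E" "x \<noteq> y"
    and walk3: "\<And>v w. \<lbrakk>{x, v} \<in> E; {v, w} \<in> E; {w, y} \<in> E\<rbrakk> \<Longrightarrow> False"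
  shows "c4_free (insert {x, y} E)"
proof -
  have new: "a = c \<or> b = d"
    if "{a, b} = {x, y}" "{b, c} \<in> insert {x, y} E" "{c, d} \<in> insert {x, y} E"
      "{d, a} \<in> insert {x, y} E" for a b c d
  proof (rule ccontr)
    assume neq: "\<not> (a = c \<or> b = d)"
    have "a \<noteq> b"
      using that(1) assms(3) by (auto simp: doubleton_eq_iff)
    have "c \<noteq> b" "d \<noteq> a"
      using that(2,4) assms(2,3) by (auto simp: loop_free_def doubleton_eq_iff)
    then have "{b, c} \<noteq> {x, y}" "{c, d} \<noteq> {x, y}" "{d, a} \<noteq> {x, y}"
      unfolding that(1)[symmetric] using neq \<open>a \<noteq> b\<close> by (auto simp: doubleton_eq_iff)
    then have cyc: "{b, c} \<in> E" "{c, d} \<in> E" "{d, a} \<in> E"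
      using that(2-4) by simp_all
    then have rev: "{a, d} \<in> E" "{d, c} \<in> E" "{c, b} \<in> E"
      by (simp_all add: insert_commute)
    have "x = a \<and> y = b \<or> x = b \<and> y = a"
      using that(1) by (auto simp: doubleton_eq_iff)
    then show False
      using walk3[of c d] walk3[of d c] cyc rev by blast
  qed
  show ?thesis
    unfolding c4_free_def
  proof (intro allI impI, elim conjE)
    fix a b c d
    assume cyc: "{a, b} \<in> insert {x, y} E" "{b, c} \<in> insert {x, y} E"
      "{c, d} \<in> insert {x, y} E" "{d, a} \<in> insert {x, y} E"
    consider "{a, b} = {x, y}" | "{b, c} = {x, y}" | "{c, d} = {x, y}" | "{d, a} = {x, y}"
      | "{a, b} \<in> E" "{b, c} \<in> E" "{c, d} \<in> E" "{d, a} \<in> E"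
      using cyc unfolding insert_iff by argo
    then show "a = c \<or> b = d"
    proof cases
      case 1 then show ?thesis using new[OF 1 cyc(2-4)] by simp
    next
      case 2 then show ?thesis using new[OF 2 cyc(3,4,1)] by blast
    next
      case 3 then show ?thesis using new[OF 3 cyc(4,1,2)] by blast
    next
      case 4 then show ?thesis using new[OF 4 cyc(1-3)] by blast
    next
      case 5 then show ?thesis using assms(1) unfolding c4_free_def by blast
    qed
  qed
qed

lemma triangle_insert:
  assumes "triangle (insert {x, y} E) a b c" "loop_free E" "x \<noteq> y"
    and walk2: "\<And>v. \<lbrakk>{x, v} \<in> E; {v, y} \<in> E\<rbrakk> \<Longrightarrow> False"
  shows "triangle E a b c"
proof -
  have old: "{p, q} \<in> E" if "triangle (insert {x, y} E) p q r" for p q r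
  proof (rule ccontr)
    assume "{p, q} \<notin> E"
    then have pq: "{p, q} = {x, y}"
      using that unfolding triangle_def insert_iff by argo
    then have "p \<noteq> q"
      using assms(3) by (auto simp: doubleton_eq_iff)
    moreover have "r \<noteq> q" "r \<noteq> p"
      using that assms(2,3) by (auto simp: triangle_def loop_free_def doubleton_eq_iff)
    ultimately have "{q, r} \<noteq> {x, y}" "{p, r} \<noteq> {x, y}"
      unfolding pq[symmetric] by (auto simp: doubleton_eq_iff)
    then have walk: "{q, r} \<in> E" "{p, r} \<in> E"
      using that by (simp_all add: triangle_def)
    then have rev: "{r, q} \<in> E" "{r, p} \<in> E"
      by (simp_all add: insert_commute)
    have "x = p \<and> y = q \<or> x = q \<and> y = p"
      using pq by (auto simp: doubleton_eq_iff)
    then show False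
      using walk2[of r] walk rev by blast
  qed
  show ?thesis
    using old[OF assms(1)] old[OF triangle_rotate[OF assms(1)]]
      old[OF triangle_rotate[OF triangle_rotate[OF assms(1)]]]
    unfolding triangle_def by (simp add: insert_commute)
qed

section \<open>Eliminating triangles\<close>

text \<open>Deleting an edge of a triangle component removes all its vertices from triangles.\<close>

lemma triangle_avoids_broken_triangle:
  assumes "loop_free E" "paw_free E" "triangle E a b c" "D \<subseteq> E" "{b, c} \<notin> D" "triangle D x y z"
  shows "x \<notin> {a, b, c}"
proof
  assume x: "x \<in> {a, b, c}"
  have xyz: "{x, y} \<in> D" "{y, z} \<in> D" "{x, z} \<in> D"
    using assms(6) by (simp_all add: triangle_def)
  then have E: "{x, y} \<in> E" "{y, z} \<in> E" "{x, z} \<in> E"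
    using assms(4) by blast+
  have "y \<in> {a, b, c}" "z \<in> {a, b, c}"
    using paw_freeD[OF assms(2,3) x E(1)] paw_freeD[OF assms(2,3) x E(3)] by blast+
  moreover have "x \<noteq> y" "y \<noteq> z" "x \<noteq> z"
    using E loop_freeD[OF assms(1)] by blast+
  ultimately have "{b, c} = {x, y} \<or> {b, c} = {y, z} \<or> {b, c} = {x, z}"
    using x by auto
  then show False
    using xyz assms(5) by auto
qed

text \<open>Replacing \<open>b c\<close> by \<open>c d\<close>, where \<open>a b c\<close> is a triangle and \<open>d\<close> lies in no triangle.\<close>

lemma hang_triangle:
  assumes "loop_free E" "c4_free E" "paw_free E" and tri: "triangle E a b c"
    and d: "d \<notin> triangle_verts E"
  defines "E' \<equiv> insert {c, d} (E - {{b, c}})"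
  shows "{c, d} \<notin> E" "loop_free E'" "c4_free E'" "paw_free E'"
    "triangle_verts E' \<subseteq> triangle_verts E - {a}"
proof -
  let ?D = "E - {{b, c}}"
  define S where "S = {a, b, c}"
  have "S \<subseteq> triangle_verts E"
    using tri triangle_rotate[OF tri] triangle_rotate[OF triangle_rotate[OF tri]]
    by (auto simp: triangle_verts_def S_def)
  then have dS: "d \<notin> S"
    using d by blast
  have cS: "c \<in> S"
    by (simp add: S_def)
  have closed: "w \<in> S" if "v \<in> S" "{v, w} \<in> E" for v w
    using paw_freeD[OF assms(3) tri] that unfolding S_def by blast
  have cd: "c \<noteq> d"
    using cS dS by blast
  show "{c, d} \<notin> E"
    using closed cS dS by blast
  have lf: "loop_free ?D"
    using assms(1) by (simp add: loop_free_def)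
  show lf': "loop_free E'"
    using lf cd by (auto simp: E'_def loop_free_def doubleton_eq_iff)
  show "c4_free E'"
    unfolding E'_def
  proof (rule c4_free_insert[OF c4_free_subset[OF assms(2)] lf cd])
    show "False" if "{c, v} \<in> ?D" "{v, w} \<in> ?D" "{w, d} \<in> ?D" for v w
      using that closed cS dS by (meson DiffD1)
  qed blast
  have old: "triangle ?D x y z" if "triangle E' x y z" for x y z
  proof (rule triangle_insert[OF that[unfolded E'_def] lf cd])
    show "False" if "{c, v} \<in> ?D" "{v, d} \<in> ?D" for v
      using that closed cS dS by (meson DiffD1)
  qed
  have oldE: "triangle E x y z" if "triangle E' x y z" for x y z
    using triangle_subset[OF old[OF that]] by blast
  have outside: "x \<notin> S" if "triangle E' x y z" for x y z
    unfolding S_def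
    by (rule triangle_avoids_broken_triangle[OF assms(1,3) tri _ _ old[OF that]]) auto
  show "triangle_verts E' \<subseteq> triangle_verts E - {a}"
    using outside oldE unfolding triangle_verts_def S_def by blast
  show "paw_free E'"
    unfolding paw_free_def
  proof (intro allI impI, elim conjE)
    fix x y z w
    assume t: "triangle E' x y z" and zw: "{z, w} \<in> E'"
    have t': "triangle E' z x y"
      using triangle_rotate[OF triangle_rotate[OF t]] .
    have "z \<noteq> c" "z \<noteq> d"
      using outside[OF t'] oldE[OF t'] cS d unfolding triangle_verts_def by blast+
    then have "{z, w} \<in> E"
      using zw by (auto simp: E'_def doubleton_eq_iff)
    then show "w = x \<or> w = y"
      using assms(3) oldE[OF t] unfolding paw_free_def by blast
  qed
qed

text \<open>Opening up two disjoint triangles \<open>a b c\<close> and \<open>d e f\<close> and joining the resulting paths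
  \<open>b a c\<close> and \<open>f d e\<close> into a six-cycle \<open>b a c f d e\<close>.\<close>

lemma merge_triangles:
  assumes "loop_free E" "c4_free E" "paw_free E" and tri: "triangle E a b c" "triangle E d e f"
    and d: "d \<notin> {a, b, c}"
  defines "E' \<equiv> insert {b, e} (insert {c, f} (E - {{b, c}, {e, f}}))"
  shows "{b, e} \<notin> E" "{c, f} \<notin> E" "{b, e} \<noteq> {c, f}" "{b, c} \<noteq> {e, f}"
    "loop_free E'" "c4_free E'" "paw_free E'" "triangle_verts E' \<subseteq> triangle_verts E - {a}"
proof -
  let ?D = "E - {{b, c}, {e, f}}"
  let ?D1 = "insert {c, f} ?D"
  define S where "S = {a, b, c}"
  have S: "a \<in> S" "b \<in> S" "c \<in> S"
    by (simp_all add: S_def)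
  have closed: "w \<in> S" if "v \<in> S" "{v, w} \<in> E" for v w
    using paw_freeD[OF assms(3) tri(1)] that unfolding S_def by blast
  have edges: "{a, b} \<in> E" "{b, c} \<in> E" "{a, c} \<in> E" "{d, e} \<in> E" "{e, f} \<in> E" "{d, f} \<in> E"
    using tri by (simp_all add: triangle_def)
  then have rev: "{e, d} \<in> E" "{f, d} \<in> E"
    by (simp_all add: insert_commute)
  have neq: "a \<noteq> b" "b \<noteq> c" "a \<noteq> c" "d \<noteq> e" "e \<noteq> f" "d \<noteq> f"
    using edges loop_freeD[OF assms(1)] by blast+
  have dS: "d \<notin> S"
    using d by (simp add: S_def)
  then have eS: "e \<notin> S" and fS: "f \<notin> S"
    using closed rev by blast+
  have disj: "b \<noteq> e" "b \<noteq> f" "c \<noteq> e" "c \<noteq> f" "a \<noteq> e" "a \<noteq> f" "d \<noteq> b" "d \<noteq> c" "d \<noteq> a"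
    using S dS eS fS by blast+
  show "{b, e} \<notin> E" "{c, f} \<notin> E"
    using closed S eS fS by blast+
  show "{b, e} \<noteq> {c, f}" "{b, c} \<noteq> {e, f}"
    using neq disj by (simp_all add: doubleton_eq_iff)
  have lf: "loop_free ?D"
    using assms(1) by (simp add: loop_free_def)
  have lf1: "loop_free ?D1"
    using lf disj by (auto simp: loop_free_def doubleton_eq_iff)
  show lf': "loop_free E'"
    using lf1 disj by (auto simp: E'_def loop_free_def doubleton_eq_iff)
  have c1: "c4_free ?D1"
  proof (rule c4_free_insert[OF c4_free_subset[OF assms(2)] lf \<open>c \<noteq> f\<close>])
    show "False" if "{c, v} \<in> ?D" "{v, w} \<in> ?D" "{w, f} \<in> ?D" for v w
      using that closed S fS by (meson DiffD1)
  qed blast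
  have t1: "triangle ?D x y z" if "triangle ?D1 x y z" for x y z
  proof (rule triangle_insert[OF that lf \<open>c \<noteq> f\<close>])
    show "False" if "{c, v} \<in> ?D" "{v, f} \<in> ?D" for v
      using that closed S fS by (meson DiffD1)
  qed
  \<comment> \<open>After adding \<open>c f\<close>, the ends of \<open>b e\<close> have the single neighbours \<open>a\<close> and \<open>d\<close>, which are
    distinct and not adjacent; so no walk of length two or three joins \<open>b\<close> and \<open>e\<close>.\<close>
  have from_b: "v = a" if "{b, v} \<in> ?D1" for v
  proof -
    have bv: "{b, v} \<in> E" "{b, v} \<noteq> {b, c}"
      using that neq disj by (auto simp: doubleton_eq_iff)
    then have "v \<in> {a, b, c}"
      using closed S unfolding S_def by blast
    then show ?thesis
      using bv loop_freeD[OF assms(1) bv(1)] by auto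
  qed
  have to_e: "v = d" if "{v, e} \<in> ?D1" for v
  proof -
    have ve: "{v, e} \<in> E" "{v, e} \<noteq> {e, f}"
      using that neq disj by (auto simp: doubleton_eq_iff)
    then have "{e, v} \<in> E"
      by (simp add: insert_commute)
    then have "v \<in> {d, e, f}"
      by (rule paw_freeD[OF assms(3) tri(2), rotated]) simp
    then show ?thesis
      using ve loop_freeD[OF assms(1) ve(1)] by (auto simp: insert_commute)
  qed
  have "{a, d} \<notin> E"
    using closed S dS by blast
  then have ad: "{a, d} \<notin> ?D1"
    using neq disj by (simp add: doubleton_eq_iff)
  show "c4_free E'"
    unfolding E'_def
  proof (rule c4_free_insert[OF c1 lf1 \<open>b \<noteq> e\<close>])
    show "False" if "{b, v} \<in> ?D1" "{v, w} \<in> ?D1" "{w, e} \<in> ?D1" for v w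
      using that(2) ad unfolding from_b[OF that(1)] to_e[OF that(3)] by (rule notE[rotated])
  qed
  have old: "triangle ?D x y z" if "triangle E' x y z" for x y z
  proof (rule t1, rule triangle_insert[OF that[unfolded E'_def] lf1 \<open>b \<noteq> e\<close>])
    show "False" if "{b, v} \<in> ?D1" "{v, e} \<in> ?D1" for v
      using from_b[OF that(1)] to_e[OF that(2)] disj by simp
  qed
  have oldE: "triangle E x y z" if "triangle E' x y z" for x y z
    using triangle_subset[OF old[OF that]] by blast
  have outside: "x \<notin> {a, b, c}" "x \<notin> {d, e, f}" if "triangle E' x y z" for x y z
    using triangle_avoids_broken_triangle[OF assms(1,3) tri(1) _ _ old[OF that]]
      triangle_avoids_broken_triangle[OF assms(1,3) tri(2) _ _ old[OF that]] by blast+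
  show "triangle_verts E' \<subseteq> triangle_verts E - {a}"
    using outside(1) oldE unfolding triangle_verts_def by blast
  show "paw_free E'"
    unfolding paw_free_def
  proof (intro allI impI, elim conjE)
    fix x y z w
    assume t: "triangle E' x y z" and zw: "{z, w} \<in> E'"
    have t': "triangle E' z x y"
      using triangle_rotate[OF triangle_rotate[OF t]] .
    have "{z, w} \<in> E"
      using zw outside[OF t'] by (auto simp: E'_def doubleton_eq_iff)
    then show "w = x \<or> w = y"
      using assms(3) oldE[OF t] unfolding paw_free_def by blast
  qed
qed

text \<open>With a single triangle component and no further vertex there is nothing to attach the opened
  triangle to: this is where four vertices are needed.\<close>

lemma eliminate_triangles:
  assumes "finite V" "card V \<ge> 4" "\<forall>e\<in>E. e \<subseteq> V \<and> card e = 2" "c4_free E" "paw_free E"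
  shows "\<exists>E'. (\<forall>e\<in>E'. e \<subseteq> V \<and> card e = 2) \<and> c4_free E' \<and> (\<forall>a b c. \<not> triangle E' a b c)
    \<and> card E' = card E"
  using assms(3-5)
proof (induction "card (triangle_verts E)" arbitrary: E rule: less_induct)
  case less
  have lf: "loop_free E"
    using less.prems(1) by (fastforce simp: loop_free_def)
  have finE: "finite E"
    by (rule finite_subset[of _ "Pow V"]) (use less.prems(1) assms(1) in auto)
  have TV: "triangle_verts E \<subseteq> V"
    using less.prems(1) by (auto simp: triangle_verts_def triangle_def)
  show ?case
  proof (cases "\<exists>a b c. triangle E a b c")
    case False
    then show ?thesis
      using less.prems by blast
  next
    case True
    then obtain a b c where tri: "triangle E a b c"
      by blast
    then have "a \<in> triangle_verts E"
      by (auto simp: triangle_verts_def)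
    then have descend: "card (triangle_verts E') < card (triangle_verts E)"
      if "triangle_verts E' \<subseteq> triangle_verts E - {a}" for E' :: "'a set set"
      using that finite_subset[OF TV assms(1)] by (intro psubset_card_mono) auto
    have bcE: "{b, c} \<in> E"
      using tri by (simp add: triangle_def)
    have abcV: "{a, b, c} \<subseteq> V"
      using tri less.prems(1) by (auto simp: triangle_def)
    show ?thesis
    proof (cases "V \<subseteq> triangle_verts E")
      case False
      then obtain d where d: "d \<in> V" "d \<notin> triangle_verts E"
        by blast
      let ?E = "insert {c, d} (E - {{b, c}})"
      note h = hang_triangle[OF lf less.prems(2,3) tri d(2)]
      have "c \<noteq> d"
        using h(2) by (auto simp: loop_free_def)
      then have simple: "\<forall>e\<in>?E. e \<subseteq> V \<and> card e = 2"
        using less.prems(1) abcV d(1) by auto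
      have "card ?E = Suc (card (E - {{b, c}}))"
        using h(1) finE by (intro card_insert_disjoint) auto
      also have "\<dots> = card E"
        by (rule card_Suc_Diff1[OF finE bcE])
      finally have "card ?E = card E" .
      then show ?thesis
        using less.hyps[OF descend[OF h(5)] simple h(3,4)] by simp
    next
      case True
      have "card {a, b, c} \<le> 3"
        by (simp add: card_insert_if)
      then have "\<not> V \<subseteq> {a, b, c}"
        using assms(2) card_mono[of "{a, b, c}" V] by auto
      then obtain d where d: "d \<in> V" "d \<notin> {a, b, c}"
        by blast
      then obtain e f where tri': "triangle E d e f"
        using True by (auto simp: triangle_verts_def)
      let ?D = "E - {{b, c}, {e, f}}"
      let ?E = "insert {b, e} (insert {c, f} ?D)"
      note h = merge_triangles[OF lf less.prems(2,3) tri tri' d(2)]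
      have efE: "{e, f} \<in> E"
        using tri' by (simp add: triangle_def)
      have "b \<noteq> e" "c \<noteq> f"
        using h(5) by (auto simp: loop_free_def)
      then have simple: "\<forall>e\<in>?E. e \<subseteq> V \<and> card e = 2"
        using less.prems(1) abcV bspec[OF less.prems(1) efE] by auto
      have "card ?E = Suc (Suc (card ?D))"
        using h(1-3) finE by simp
      also have "card ?D = card E - 2"
        using h(4) bcE efE finE by (subst card_Diff_subset) auto
      also have "Suc (Suc (card E - 2)) = card E"
        using h(4) bcE efE card_mono[OF finE, of "{{b, c}, {e, f}}"] by auto
      finally have "card ?E = card E" .
      then show ?thesis
        using less.hyps[OF descend[OF h(8)] simple h(6,7)] by simp
    qed
  qed
qed

section \<open>Copies as injective maps\<close>

lemma image_simple_graph:
  assumes "simple_graph G" "inj_on f (verts G)"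
  shows "simple_graph \<lparr>verts = f ` verts G, edges = (`) f ` edges G\<rparr>"
proof -
  have "card (f ` e) = 2" if "e \<in> edges G" for e
    using that assms by (metis simple_graph_def card_image inj_on_subset)
  then show ?thesis
    using assms(1) by (auto simp: simple_graph_def)
qed

lemma isomorphic_image:
  assumes "simple_graph G" "inj_on f (verts G)"
  shows "isomorphic \<lparr>verts = f ` verts G, edges = (`) f ` edges G\<rparr> G"
proof -
  let ?g = "inv_into (verts G) f"
  have "?g ` f ` e = e" if "e \<in> edges G" for e
    using that assms by (simp add: simple_graph_def inv_into_image_cancel)
  then have "edges G = (`) ?g ` (`) f ` edges G"
    by (force simp: image_image)
  then show ?thesis
    using inj_on_imp_bij_betw[OF assms(2)] bij_betw_inv_into
    unfolding isomorphic_def by fastforce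
qed

lemma isomorphic_imp_image:
  assumes "simple_graph G'" "isomorphic G' G"
  obtains f where "inj_on f (verts G)" "verts G' = f ` verts G" "edges G' = (`) f ` edges G"
proof -
  obtain g where g: "bij_betw g (verts G') (verts G)" "edges G = (`) g ` edges G'"
    using assms(2) by (auto simp: isomorphic_def)
  let ?f = "inv_into (verts G') g"
  have f: "bij_betw ?f (verts G) (verts G')"
    by (rule bij_betw_inv_into[OF g(1)])
  have "?f ` g ` e = e" if "e \<in> edges G'" for e
    using that assms(1) g(1)
    by (simp add: simple_graph_def inv_into_image_cancel bij_betw_imp_inj_on)
  then have "edges G' = (`) ?f ` edges G"
    unfolding g(2) by (force simp: image_image)
  then show ?thesis
    using that f by (auto simp: bij_betw_def)
qed

lemma contains_copy_iff:
  assumes "simple_graph H" "simple_graph G"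
  shows "contains_copy H G \<longleftrightarrow>
    (\<exists>f. inj_on f (verts G) \<and> f ` verts G \<subseteq> verts H \<and> (\<forall>e\<in>edges G. f ` e \<in> edges H))"
proof
  assume "contains_copy H G"
  then obtain G' where "subgraph G' H" "isomorphic G' G"
    by (auto simp: contains_copy_def)
  moreover from this obtain f where
    "inj_on f (verts G)" "verts G' = f ` verts G" "edges G' = (`) f ` edges G"
    by (meson isomorphic_imp_image subgraph_def)
  ultimately show "\<exists>f. inj_on f (verts G) \<and> f ` verts G \<subseteq> verts H \<and> (\<forall>e\<in>edges G. f ` e \<in> edges H)"
    by (intro exI[of _ f]) (auto simp: subgraph_def)
next
  assume "\<exists>f. inj_on f (verts G) \<and> f ` verts G \<subseteq> verts H \<and> (\<forall>e\<in>edges G. f ` e \<in> edges H)"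
  then obtain f where f: "inj_on f (verts G)" "f ` verts G \<subseteq> verts H" "\<forall>e\<in>edges G. f ` e \<in> edges H"
    by blast
  then have "subgraph \<lparr>verts = f ` verts G, edges = (`) f ` edges G\<rparr> H"
    using image_simple_graph[OF assms(2) f(1)] assms(1) by (auto simp: subgraph_def)
  then show "contains_copy H G"
    using isomorphic_image[OF assms(2) f(1)] by (auto simp: contains_copy_def)
qed

text \<open>A subgraph of the order of \<open>G\<close> that properly contains \<open>G\<close> amounts to a copy of \<open>G\<close> together
  with one further edge between vertices of that copy.\<close>

lemma contains_copy_properly_iff:
  assumes H: "simple_graph H" and G: "simple_graph G"
  shows "(\<exists>F. subgraph F H \<and> card (verts F) = card (verts G) \<and> contains_copy_properly F G) \<longleftrightarrow>
    (\<exists>f. inj_on f (verts G) \<and> f ` verts G \<subseteq> verts H \<and> (\<forall>e\<in>edges G. f ` e \<in> edges H) \<and>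
      (\<exists>e\<in>edges H. e \<subseteq> f ` verts G \<and> e \<notin> (`) f ` edges G))" (is "?L \<longleftrightarrow> ?R")
proof
  assume ?L
  then obtain F G' where F: "subgraph F H" "card (verts F) = card (verts G)"
    and G': "subgraph G' F" "G' \<noteq> F" "isomorphic G' G"
    by (auto simp: contains_copy_properly_def proper_subgraph_def)
  then obtain f where f: "inj_on f (verts G)" "verts G' = f ` verts G" "edges G' = (`) f ` edges G"
    by (meson isomorphic_imp_image subgraph_def)
  have "card (verts G') = card (verts F)"
    using f F(2) by (simp add: card_image)
  then have verts: "verts G' = verts F"
    using G'(1) by (intro card_subset_eq) (auto simp: subgraph_def simple_graph_def)
  then have "edges G' \<noteq> edges F"
    using G'(2) by (metis graph.surjective old.unit.exhaust)
  then obtain e where "e \<in> edges F" "e \<notin> edges G'"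
    using G'(1) by (auto simp: subgraph_def)
  moreover from this have "e \<subseteq> f ` verts G"
    using F(1) verts f(2) by (auto simp: subgraph_def simple_graph_def)
  ultimately have "e \<in> edges H" "e \<subseteq> f ` verts G" "e \<notin> (`) f ` edges G"
    using F(1) f(3) by (auto simp: subgraph_def)
  moreover have "f ` verts G \<subseteq> verts H" "\<forall>e\<in>edges G. f ` e \<in> edges H"
    using F(1) G'(1) f(2,3) by (auto simp: subgraph_def)
  ultimately show ?R
    using f(1) by blast
next
  assume ?R
  then obtain f e where f: "inj_on f (verts G)" "f ` verts G \<subseteq> verts H" "\<forall>e\<in>edges G. f ` e \<in> edges H"
    and e: "e \<in> edges H" "e \<subseteq> f ` verts G" "e \<notin> (`) f ` edges G"
    by blast
  let ?G' = "\<lparr>verts = f ` verts G, edges = (`) f ` edges G\<rparr>"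
  let ?F = "\<lparr>verts = f ` verts G, edges = insert e ((`) f ` edges G)\<rparr>"
  have G': "simple_graph ?G'"
    by (rule image_simple_graph[OF G f(1)])
  moreover have "card e = 2"
    using H e(1) by (auto simp: simple_graph_def)
  ultimately have F: "simple_graph ?F"
    using e(2) by (auto simp: simple_graph_def)
  have "subgraph ?F H"
    using F H f e by (auto simp: subgraph_def)
  moreover have "proper_subgraph ?G' ?F"
    using F G' e(3) by (auto simp: proper_subgraph_def subgraph_def)
  moreover have "card (verts ?F) = card (verts G)"
    using f(1) by (simp add: card_image)
  ultimately show ?L
    using isomorphic_image[OF G f(1)] unfolding contains_copy_properly_def by blast
qed

section \<open>The three forbidden configurations\<close>

lemma verts_path4: "verts (path_graph 4) = {0, 1, 2, 3}"
  by (auto simp: path_graph_def)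

lemma edges_path4: "edges (path_graph 4) = {{0, 1}, {1, 2}, {2, 3}}"
proof -
  have "edges (path_graph 4) = (\<lambda>i. {i, Suc i}) ` {..<3}"
    by (auto simp: path_graph_def)
  also have "{..<3} = {0, 1, 2::nat}"
    by auto
  finally show ?thesis
    by (simp add: numeral_2_eq_2 numeral_3_eq_3)
qed

lemma verts_cycle3: "verts (cycle_graph 3) = {0, 1, 2}"
  by (auto simp: cycle_graph_def)

lemma edges_cycle3: "edges (cycle_graph 3) = {{0, 1}, {1, 2}, {2, 0}}"
proof -
  have "edges (cycle_graph 3) = (\<lambda>i. {i, Suc i mod 3}) ` {..<3}"
    by (auto simp: cycle_graph_def)
  also have "{..<3} = {0, 1, 2::nat}"
    by auto
  finally show ?thesis
    by (simp flip: numeral_2_eq_2)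
qed

lemma verts_cycle4: "verts (cycle_graph 4) = {0, 1, 2, 3}"
  by (auto simp: cycle_graph_def)

lemma edges_cycle4: "edges (cycle_graph 4) = {{0, 1}, {1, 2}, {2, 3}, {3, 0}}"
proof -
  have "edges (cycle_graph 4) = (\<lambda>i. {i, Suc i mod 4}) ` {..<4}"
    by (auto simp: cycle_graph_def)
  also have "{..<4} = {0, 1, 2, 3::nat}"
    by auto
  finally show ?thesis
    by (simp flip: numeral_2_eq_2)
qed

lemma simple_graph_edge:
  assumes "simple_graph H" "{x, y} \<in> edges H"
  shows "x \<noteq> y" "x \<in> verts H" "y \<in> verts H"
proof -
  have "{x, y} \<subseteq> verts H" "card {x, y} = 2"
    using assms by (auto simp: simple_graph_def)
  then show "x \<noteq> y" "x \<in> verts H" "y \<in> verts H"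
    by auto
qed

lemma contains_triangle_iff:
  assumes "simple_graph H"
  shows "contains_copy H (cycle_graph 3) \<longleftrightarrow> (\<exists>a b c. triangle (edges H) a b c)"
proof -
  have "simple_graph (cycle_graph 3)"
    by (simp add: simple_graph_def verts_cycle3 edges_cycle3)
  note iff = contains_copy_iff[OF assms this, unfolded verts_cycle3 edges_cycle3]
  show ?thesis
  proof
    assume "contains_copy H (cycle_graph 3)"
    then show "\<exists>a b c. triangle (edges H) a b c"
      unfolding iff triangle_def by (auto simp: insert_commute)
  next
    assume "\<exists>a b c. triangle (edges H) a b c"
    then obtain a b c where t: "{a, b} \<in> edges H" "{b, c} \<in> edges H" "{a, c} \<in> edges H"
      by (auto simp: triangle_def)
    show "contains_copy H (cycle_graph 3)"
      unfolding iff
      by (rule exI[of _ "(\<lambda>_. c)(0 := a, 1 := b)"])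
        (use t simple_graph_edge[OF assms t(1)] simple_graph_edge[OF assms t(2)]
          simple_graph_edge[OF assms t(3)] in \<open>auto simp: insert_commute\<close>)
  qed
qed

lemma contains_four_cycle_iff:
  assumes "simple_graph H"
  shows "contains_copy H (cycle_graph 4) \<longleftrightarrow> \<not> c4_free (edges H)"
proof -
  have "simple_graph (cycle_graph 4)"
    by (simp add: simple_graph_def verts_cycle4 edges_cycle4)
  note iff = contains_copy_iff[OF assms this, unfolded verts_cycle4 edges_cycle4]
  show ?thesis
  proof
    assume "contains_copy H (cycle_graph 4)"
    then obtain f :: "nat \<Rightarrow> 'a" where "f 0 \<noteq> f 2" "f 1 \<noteq> f 3" "{f 0, f 1} \<in> edges H"
      "{f 1, f 2} \<in> edges H" "{f 2, f 3} \<in> edges H" "{f 3, f 0} \<in> edges H"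
      unfolding iff by auto
    then show "\<not> c4_free (edges H)"
      unfolding c4_free_def by blast
  next
    assume "\<not> c4_free (edges H)"
    then obtain a b c d where t: "{a, b} \<in> edges H" "{b, c} \<in> edges H" "{c, d} \<in> edges H"
      "{d, a} \<in> edges H" "a \<noteq> c" "b \<noteq> d"
      by (auto simp: c4_free_def)
    show "contains_copy H (cycle_graph 4)"
      unfolding iff
      by (rule exI[of _ "(\<lambda>_. d)(0 := a, 1 := b, 2 := c)"])
        (use t simple_graph_edge[OF assms t(1)] simple_graph_edge[OF assms t(2)]
          simple_graph_edge[OF assms t(3)] simple_graph_edge[OF assms t(4)]
          in \<open>auto simp: insert_commute\<close>)
  qed
qed

lemma extended_path_iff:
  assumes "simple_graph H"
  shows "(\<exists>F. subgraph F H \<and> card (verts F) = card (verts (path_graph 4)) \<and>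
      contains_copy_properly F (path_graph 4)) \<longleftrightarrow>
    \<not> (c4_free (edges H) \<and> paw_free (edges H))"
proof -
  have "simple_graph (path_graph 4)"
    by (simp add: simple_graph_def verts_path4 edges_path4)
  note iff = contains_copy_properly_iff[OF assms this]
  have "(\<exists>f. inj_on f (verts (path_graph 4)) \<and> f ` verts (path_graph 4) \<subseteq> verts H \<and>
      (\<forall>e\<in>edges (path_graph 4). f ` e \<in> edges H) \<and>
      (\<exists>e\<in>edges H. e \<subseteq> f ` verts (path_graph 4) \<and> e \<notin> (`) f ` edges (path_graph 4))) \<longleftrightarrow>
    \<not> (c4_free (edges H) \<and> paw_free (edges H))" (is "?L \<longleftrightarrow> ?R")
  proof
    assume ?L
    then obtain f :: "nat \<Rightarrow> 'a" and e where inj: "inj_on f {0, 1, 2, 3}"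
      and path: "{f 0, f 1} \<in> edges H" "{f 1, f 2} \<in> edges H" "{f 2, f 3} \<in> edges H"
      and e: "e \<in> edges H" "e \<subseteq> {f 0, f 1, f 2, f 3}"
        "e \<notin> {{f 0, f 1}, {f 1, f 2}, {f 2, f 3}}"
      unfolding verts_path4 edges_path4 by auto
    obtain x y where xy: "e = {x, y}" "x \<noteq> y"
      using assms e(1) by (auto simp: simple_graph_def card_2_iff)
    have neq: "f 0 \<noteq> f 2" "f 0 \<noteq> f 3" "f 1 \<noteq> f 3"
      using inj by auto
    \<comment> \<open>The extra edge closes the path to a four-cycle or cuts off a triangle at one of its ends.\<close>
    consider "e = {f 0, f 3}" | "e = {f 0, f 2}" | "e = {f 1, f 3}"
      using e xy by (auto simp: insert_commute)
    then show ?R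
    proof cases
      case 1
      then have "{f 3, f 0} \<in> edges H"
        using e(1) by (simp add: insert_commute)
      then show ?thesis
        using path neq unfolding c4_free_def by blast
    next
      case 2
      then have "triangle (edges H) (f 0) (f 1) (f 2)"
        using path e(1) by (simp add: triangle_def)
      then have "\<not> paw_free (edges H)"
        using path(3) neq unfolding paw_free_def by metis
      then show ?thesis by blast
    next
      case 3
      then have "triangle (edges H) (f 2) (f 3) (f 1)"
        using path e(1) by (simp add: triangle_def insert_commute)
      moreover have "{f 1, f 0} \<in> edges H"
        using path(1) by (simp add: insert_commute)
      ultimately have "\<not> paw_free (edges H)"
        using neq unfolding paw_free_def by metis
      then show ?thesis by blast
    qed
  next
    have copy: ?L if t: "{a, b} \<in> edges H" "{b, c} \<in> edges H" "{c, d} \<in> edges H"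
      and neq: "a \<noteq> c" "a \<noteq> d" "b \<noteq> d" and e: "{a, c} \<in> edges H \<or> {a, d} \<in> edges H" for a b c d
    proof -
      define f :: "nat \<Rightarrow> 'a" where "f = (\<lambda>_. d)(0 := a, 1 := b, 2 := c)"
      have f: "f 0 = a" "f 1 = b" "f 2 = c" "f 3 = d"
        by (simp_all add: f_def)
      note edge1 = simple_graph_edge[OF assms t(1)] and edge2 = simple_graph_edge[OF assms t(2)]
        and edge3 = simple_graph_edge[OF assms t(3)]
      have "inj_on f {0, 1, 2, 3}"
        using neq edge1(1) edge2(1) edge3(1) f by (auto simp: inj_on_def)
      moreover have "f ` {0, 1, 2, 3} = {a, b, c, d}"
        "(`) f ` {{0, 1}, {1, 2}, {2, 3}} = {{a, b}, {b, c}, {c, d}}"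
        unfolding image_insert image_empty f by simp_all
      moreover have "{a, b, c, d} \<subseteq> verts H"
        using edge1 edge2 edge3 by blast
      moreover have "\<forall>e\<in>{{0, 1}, {1, 2}, {2, 3}}. f ` e \<in> edges H"
        unfolding ball_simps image_insert image_empty f using t by simp
      moreover have "{a, c} \<notin> {{a, b}, {b, c}, {c, d}}" "{a, d} \<notin> {{a, b}, {b, c}, {c, d}}"
        using neq edge1(1) edge2(1) edge3(1) by (auto simp: doubleton_eq_iff)
      moreover have "{a, c} \<subseteq> {a, b, c, d}" "{a, d} \<subseteq> {a, b, c, d}"
        by blast+
      ultimately show ?thesis
        unfolding verts_path4 edges_path4 using e by (metis (no_types, lifting))
    qed
    assume ?R
    then consider "\<not> c4_free (edges H)" | "\<not> paw_free (edges H)"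
      by blast
    then show ?L
    proof cases
      case 1
      then obtain a b c d where t: "{a, b} \<in> edges H" "{b, c} \<in> edges H" "{c, d} \<in> edges H"
        "{d, a} \<in> edges H" "a \<noteq> c" "b \<noteq> d"
        by (auto simp: c4_free_def)
      then show ?thesis
        using copy[of a b c d] simple_graph_edge(1)[OF assms t(4)] by (auto simp: insert_commute)
    next
      case 2
      then obtain a b c d where t: "{a, b} \<in> edges H" "{b, c} \<in> edges H" "{a, c} \<in> edges H"
        "{c, d} \<in> edges H" "d \<noteq> a" "d \<noteq> b"
        by (auto simp: paw_free_def triangle_def)
      then show ?thesis
        using copy[of a b c d] simple_graph_edge(1)[OF assms t(3)] by auto
    qed
  qed
  then show ?thesis
    unfolding iff .
qed

theorem theorem13:
  fixes n :: nat
  assumes "n \<ge> 4"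
  shows "st n (path_graph 4) = ex n {cycle_graph 3, cycle_graph 4}"
proof -
  \<comment> \<open>The predicates under the two maxima, to be shown to realise the same edge counts.\<close>
  let ?st = "\<lambda>H :: nat graph. \<not> (\<exists>F. subgraph F H \<and>
    card (verts F) = card (verts (path_graph 4)) \<and> contains_copy_properly F (path_graph 4))"
  let ?ex = "\<lambda>H :: nat graph. \<forall>G\<in>{cycle_graph 3, cycle_graph 4}. \<not> contains_copy H G"
  have ex_iff: "?ex H \<longleftrightarrow> c4_free (edges H) \<and> (\<forall>a b c. \<not> triangle (edges H) a b c)"
    if "simple_graph H" for H
    using contains_triangle_iff[OF that] contains_four_cycle_iff[OF that] by auto
  have "{card (edges H) | H. simple_graph H \<and> card (verts H) = n \<and> ?st H} =
    {card (edges H) | H. simple_graph H \<and> card (verts H) = n \<and> ?ex H}" (is "?S = ?X")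
  proof (intro equalityI subsetI)
    fix m
    assume "m \<in> ?S"
    then obtain H :: "nat graph" where m: "m = card (edges H)" and H: "simple_graph H"
      "card (verts H) = n" and "?st H"
      by blast
    then have free: "c4_free (edges H)" "paw_free (edges H)"
      using extended_path_iff[OF H(1)] by blast+
    have V: "finite (verts H)" "card (verts H) \<ge> 4" "\<forall>e\<in>edges H. e \<subseteq> verts H \<and> card e = 2"
      using H assms by (auto simp: simple_graph_def)
    obtain E where E: "\<forall>e\<in>E. e \<subseteq> verts H \<and> card e = 2" "c4_free E"
      "\<forall>a b c. \<not> triangle E a b c" "card E = m"
      using eliminate_triangles[OF V free] m by blast
    let ?H = "\<lparr>verts = verts H, edges = E\<rparr>"
    have "simple_graph ?H"
      using E(1) V(1) by (simp add: simple_graph_def)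
    moreover from this have "?ex ?H"
      using ex_iff E(2,3) by simp
    ultimately show "m \<in> ?X"
      using H(2) E(4) by (intro CollectI exI[of _ ?H]) simp
  next
    fix m
    assume "m \<in> ?X"
    then obtain H :: "nat graph" where m: "m = card (edges H)" and H: "simple_graph H"
      "card (verts H) = n" and "?ex H"
      by blast
    then have "c4_free (edges H)" "paw_free (edges H)"
      using ex_iff unfolding paw_free_def by blast+
    then show "m \<in> ?S"
      using extended_path_iff[OF H(1)] m H by blast
  qed
  then show ?thesis
    unfolding st_def ex_def by (rule arg_cong)
qed

end
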